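(* Let $V$ be Kato-decomposable with ground state $\varphi_0\in L^2(\mathbf{R}^d)\cap L^1(\mathbf{R}^d)$, and let $\mu$ be the fractional $P(\phi)_1$-measure for $V$ on the space $\Omega=D_{\rm r}(\mathbf{R},\mathbf{R}^d)$. Let $(a_n)_{n\ge 1}$ be a sequence of positive real numbers such that $\sum_{n=1}^\infty a_n<\infty$. Then $$\lim_{|N|\to\infty}\frac{a_{|N|}}{\varphi_0(\omega(N))}=0\quad\text{for }\mu\text{-a.e. }\omega\in\Omega,$$ where $N$ runs over the integers.
   Context: Let $d\ge 1$, $\alpha\in(0,2)$, and let $(X_t)_{t\ge 0}$ be the rotationally invariant $\alpha$-stable process on $\mathbf{R}^d$ with càdlàg paths, $\mathbf{E}^0[e^{i\xi\cdot X_t}]=e^{-t|\xi|^\alpha}$; $\mathbf{P}^x,\mathbf{E}^x$ are law and expectation for the process started at $x$. A Borel function $W$ on $\mathbf{R}^d$ is in $\mathcal{K}^\alpha$ if $\lim_{t\to 0}\sup_x\int_0^t\mathbf{E}^x[|W(X_s)|]ds=0$, and in $\mathcal{K}^\alpha_{\rm loc}$ if $W\mathbf{1}_B\in\mathcal{K}^\alpha$ for every ball $B$. A Borel function $V:\mathbf{R}^d\to\mathbf{R}$ is Kato-decomposable if its positive and negative parts ($V=V_+-V_-$) satisfy $V_+\in\mathcal{K}^\alpha_{\rm loc}$, $V_-\in\mathcal{K}^\alpha$. The Feynman-Kac semigroup is $T_tf(x)=\mathbf{E}^x[e^{-\int_0^tV(X_s)ds}f(X_t)]$; it is a strongly continuous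 symmetric semigroup on $L^2(\mathbf{R}^d)$, and $H_\alpha$ denotes the self-adjoint operator bounded from below with $e^{-tH_\alpha}=T_t$. For $t>0$, $T_t$ has a bounded, continuous, symmetric, strictly positive integral kernel $u(t,x,y)$. Standing assumption: $\lambda_0=\inf\operatorname{Spec}H_\alpha$ is an isolated eigenvalue; the corresponding eigenfunction with $\|\varphi_0\|_2=1$ is the ground state $\varphi_0$, taken in its strictly positive, bounded, continuous version. Put $\widetilde u(t,x,y)=\frac{e^{\lambda_0t}u(t,x,y)}{\varphi_0(x)\varphi_0(y)}$. $\Omega=D_{\rm r}(\mathbf{R},\mathbf{R}^d)$ is the space of right continuous functions with left limits, $\mathcal{F}$ the $\sigma$-field generated by the coordinate process $\widetilde X_t(\omega)=\omega(t)$. For $x\in\mathbf{R}^d$, $\mu^x$ is the probability measure on $(\Omega,\mathcal{F})$ under which $\widetilde X_0=x$ a.s., $(\widetilde X_t)_{t\ge0}$ and $(\widetilde X_{-t})_{t\ge0}$ are independent, and each of them is a Markov process with transition probabilities $\widetilde u(t,y,z)\varphi_0^2(z)dz$. The fractional $P(\phi)_1$-measure for $V$ is $\mu(A)=\int_{\mathbf{R}^d}\mu^x(A)\varphi_0^2(x)dx$, $A\in\mathcal{F}$. *)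

theory Defs
  imports "HOL-Probability.Probability"
begin

section \<open>Processes\<close>

definition cadlag_on :: "real set \<Rightarrow> (real \<Rightarrow> 'a::topological_space) \<Rightarrow> bool" where
  "cadlag_on I \<omega> \<longleftrightarrow>
     (\<forall>t\<in>I. (\<omega> \<longlongrightarrow> \<omega> t) (at t within I \<inter> {t<..}) \<and>
            (\<exists>l. (\<omega> \<longlongrightarrow> l) (at t within I \<inter> {..<t})))"

text \<open>The \<open>\<sigma>\<close>-field generated by the random variables \<open>Y r\<close>, \<open>r \<in> I\<close>.\<close>

definition generated ::
    "'w measure \<Rightarrow> (real \<Rightarrow> 'w \<Rightarrow> 'a::topological_space) \<Rightarrow> real set \<Rightarrow> 'w measure" where
  "generated M Y I =
     vimage_algebra (space M) (\<lambda>\<omega>. \<lambda>r\<in>I. Y r \<omega>) (\<Pi>\<^sub>M r\<in>I. borel)"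

text \<open>
  The process started at \<open>0\<close>, with time set \<open>{0..}\<close>; values of \<open>X\<close> at negative times play no role.
  It is realised on an arbitrary probability space, and the law \<open>P\<^sup>x\<close> of the process started
  at \<open>x\<close> is the law of \<open>x + X\<close>.
\<close>

definition stable_process ::
    "real \<Rightarrow> 'w measure \<Rightarrow> (real \<Rightarrow> 'w \<Rightarrow> 'a::euclidean_space) \<Rightarrow> bool" where
  "stable_process \<alpha> M X \<longleftrightarrow>
     prob_space M \<and>
     (\<forall>t\<ge>0. X t \<in> borel_measurable M) \<and>
     (AE \<omega> in M. X 0 \<omega> = 0) \<and>
     (\<forall>\<omega>\<in>space M. cadlag_on {0..} (\<lambda>t. X t \<omega>)) \<and>
     (\<forall>s\<ge>0. \<forall>t>s. prob_space.indep_set M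
        (sets (generated M X {0..s}))
        (sets (vimage_algebra (space M) (\<lambda>\<omega>. X t \<omega> - X s \<omega>) borel))) \<and>
     (\<forall>s\<ge>0. \<forall>t>s.
        distr M borel (\<lambda>\<omega>. X t \<omega> - X s \<omega>) = distr M borel (X (t - s))) \<and>
     (\<forall>t\<ge>0. \<forall>\<xi>. (LINT \<omega>|M. iexp (\<xi> \<bullet> X t \<omega>)) = of_real (exp (- t * norm \<xi> powr \<alpha>)))"

text \<open>Time-homogeneous Markov property of \<open>(Y t)\<close>, \<open>t \<ge> 0\<close>, relative to its own filtration;
  \<open>p t y\<close> is the transition probability from \<open>y\<close> in time \<open>t > 0\<close>.\<close>

definition markov_process ::
    "'w measure \<Rightarrow> (real \<Rightarrow> 'a \<Rightarrow> 'a::euclidean_space measure) \<Rightarrow> (real \<Rightarrow> 'w \<Rightarrow> 'a) \<Rightarrow> bool" where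
  "markov_process M p Y \<longleftrightarrow>
     (\<forall>t\<ge>0. Y t \<in> borel_measurable M) \<and>
     (\<forall>s\<ge>0. \<forall>t>0. \<forall>B\<in>sets borel.
        AE \<omega> in M. real_cond_exp M (generated M Y {0..s}) (\<lambda>\<omega>'. indicator B (Y (s + t) \<omega>')) \<omega>
                   = measure (p t (Y s \<omega>)) B)"

section \<open>Kato class and Feynman-Kac semigroup\<close>

definition kato ::
    "'w measure \<Rightarrow> (real \<Rightarrow> 'w \<Rightarrow> 'a::euclidean_space) \<Rightarrow> ('a \<Rightarrow> real) \<Rightarrow> bool" where
  "kato M X W \<longleftrightarrow>
     W \<in> borel_measurable borel \<and>
     ((\<lambda>t. SUP x. \<integral>\<^sup>+s\<in>{0..t}. (\<integral>\<^sup>+\<omega>. ennreal \<bar>W (x + X s \<omega>)\<bar> \<partial>M) \<partial>lborel) \<longlongrightarrow> 0) (at_right 0)"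

definition kato_loc ::
    "'w measure \<Rightarrow> (real \<Rightarrow> 'w \<Rightarrow> 'a::euclidean_space) \<Rightarrow> ('a \<Rightarrow> real) \<Rightarrow> bool" where
  "kato_loc M X W \<longleftrightarrow>
     W \<in> borel_measurable borel \<and>
     (\<forall>c r. kato M X (\<lambda>x. W x * indicator (ball c r) x))"

definition kato_decomposable ::
    "'w measure \<Rightarrow> (real \<Rightarrow> 'w \<Rightarrow> 'a::euclidean_space) \<Rightarrow> ('a \<Rightarrow> real) \<Rightarrow> bool" where
  "kato_decomposable M X V \<longleftrightarrow>
     V \<in> borel_measurable borel \<and>
     kato_loc M X (\<lambda>x. max (V x) 0) \<and> kato M X (\<lambda>x. max (- V x) 0)"

definition feynman_kac ::
    "'w measure \<Rightarrow> (real \<Rightarrow> 'w \<Rightarrow> 'a::euclidean_space) \<Rightarrow> ('a \<Rightarrow> real) \<Rightarrow>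
     real \<Rightarrow> ('a \<Rightarrow> complex) \<Rightarrow> 'a \<Rightarrow> complex" where
  "feynman_kac M X V t f x =
     (LINT \<omega>|M. of_real (exp (- (LINT s:{0..t}|lborel. V (x + X s \<omega>)))) * f (x + X t \<omega>))"

section \<open>Operators on the complex $L^2$ space\<close>

text \<open>
  Elements of $L^2$ are represented by square-integrable Borel functions, without passing to
  a.e.-classes. A (possibly unbounded) operator \<open>H\<close> is given by its graph: \<open>H f g\<close> means that
  \<open>f\<close> lies in the domain and \<open>g\<close> is a version of \<open>H f\<close>.
\<close>

definition L2 :: "('a::euclidean_space \<Rightarrow> complex) set" where
  "L2 = {f \<in> borel_measurable borel. integrable lborel (\<lambda>x. (cmod (f x))\<^sup>2)}"

definition l2norm :: "('a::euclidean_space \<Rightarrow> complex) \<Rightarrow> real" where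
  "l2norm f = sqrt (LINT x|lborel. (cmod (f x))\<^sup>2)"

definition l2inner :: "('a::euclidean_space \<Rightarrow> complex) \<Rightarrow> ('a \<Rightarrow> complex) \<Rightarrow> complex" where
  "l2inner f g = (LINT x|lborel. cnj (f x) * g x)"

type_synonym 'a l2_operator = "('a \<Rightarrow> complex) \<Rightarrow> ('a \<Rightarrow> complex) \<Rightarrow> bool"

text \<open>The second conjunct says that the graphs of \<open>H\<close> and of its adjoint coincide.\<close>

definition self_adjoint :: "'a::euclidean_space l2_operator \<Rightarrow> bool" where
  "self_adjoint H \<longleftrightarrow>
     (\<forall>f\<in>L2. \<forall>\<epsilon>>0. \<exists>h k. H h k \<and> l2norm (\<lambda>x. f x - h x) < \<epsilon>) \<and>
     (\<forall>f g. H f g \<longleftrightarrow>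
        f \<in> L2 \<and> g \<in> L2 \<and> (\<forall>h k. H h k \<longrightarrow> l2inner k f = l2inner h g))"

definition bounded_from_below :: "'a::euclidean_space l2_operator \<Rightarrow> bool" where
  "bounded_from_below H \<longleftrightarrow>
     (\<exists>c::real. \<forall>f g. H f g \<longrightarrow> c * (l2norm f)\<^sup>2 \<le> Re (l2inner f g))"

text \<open>$e^{-tH} = T_t$ for all $t$, in the sense of semigroup theory: $-H$ is the infinitesimal
  generator of the semigroup \<open>T\<close>, that is, $Hf = \lim_{t \downarrow 0} (f - T_t f)/t$ in $L^2$,
  with domain the set of all \<open>f\<close> for which this limit exists.\<close>

definition exp_semigroup ::
    "'a::euclidean_space l2_operator \<Rightarrow> (real \<Rightarrow> ('a \<Rightarrow> complex) \<Rightarrow> 'a \<Rightarrow> complex) \<Rightarrow> bool" where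
  "exp_semigroup H T \<longleftrightarrow>
     (\<forall>f g. H f g \<longleftrightarrow>
        f \<in> L2 \<and> g \<in> L2 \<and>
        ((\<lambda>t. l2norm (\<lambda>x. (f x - T t f x) / of_real t - g x)) \<longlongrightarrow> 0) (at_right 0))"

definition schroedinger_operator ::
    "'w measure \<Rightarrow> (real \<Rightarrow> 'w \<Rightarrow> 'a::euclidean_space) \<Rightarrow> ('a \<Rightarrow> real) \<Rightarrow> 'a l2_operator \<Rightarrow> bool" where
  "schroedinger_operator M X V H \<longleftrightarrow>
     self_adjoint H \<and> bounded_from_below H \<and> exp_semigroup H (feynman_kac M X V)"

text \<open>\<open>z\<close> is in the resolvent set iff \<open>H - z\<close> maps its domain onto $L^2$ and has a bounded
  inverse; the estimate contains the injectivity of \<open>H - z\<close>.\<close>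

definition resolvent_set :: "'a::euclidean_space l2_operator \<Rightarrow> complex set" where
  "resolvent_set H =
     {z. (\<forall>g\<in>L2. \<exists>f. H f (\<lambda>x. g x + z * f x)) \<and>
         (\<exists>C. \<forall>f g. H f g \<longrightarrow> l2norm f \<le> C * l2norm (\<lambda>x. g x - z * f x))}"

definition spectrum_of :: "'a::euclidean_space l2_operator \<Rightarrow> complex set" where
  "spectrum_of H = - resolvent_set H"

definition eigenvalue_of :: "'a::euclidean_space l2_operator \<Rightarrow> complex \<Rightarrow> bool" where
  "eigenvalue_of H z \<longleftrightarrow>
     (\<exists>f. H f (\<lambda>x. z * f x) \<and> \<not> (AE x in lborel. f x = 0))"

text \<open>Only used for self-adjoint operators bounded from below, whose spectrum is a nonempty subset
  of the real line that is bounded from below.\<close>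

definition inf_spectrum :: "'a::euclidean_space l2_operator \<Rightarrow> real" where
  "inf_spectrum H = Inf (Re ` spectrum_of H)"

definition ground_state :: "'a::euclidean_space l2_operator \<Rightarrow> ('a \<Rightarrow> real) \<Rightarrow> bool" where
  "ground_state H \<phi> \<longleftrightarrow>
     H (\<lambda>x. of_real (\<phi> x)) (\<lambda>x. of_real (inf_spectrum H) * of_real (\<phi> x)) \<and>
     l2norm (\<lambda>x. of_real (\<phi> x)) = 1 \<and>
     (\<forall>x. \<phi> x > 0) \<and> bounded (range \<phi>) \<and> continuous_on UNIV \<phi>"

text \<open>By continuity these conditions determine the kernel uniquely.\<close>

definition feynman_kac_kernel ::
    "'w measure \<Rightarrow> (real \<Rightarrow> 'w \<Rightarrow> 'a::euclidean_space) \<Rightarrow> ('a \<Rightarrow> real) \<Rightarrow>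
     (real \<Rightarrow> 'a \<Rightarrow> 'a \<Rightarrow> real) \<Rightarrow> bool" where
  "feynman_kac_kernel M X V u \<longleftrightarrow>
     (\<forall>t>0.
        bounded (range (\<lambda>(x, y). u t x y)) \<and>
        continuous_on UNIV (\<lambda>(x, y). u t x y) \<and>
        (\<forall>x y. u t x y = u t y x) \<and>
        (\<forall>x y. u t x y > 0) \<and>
        (\<forall>f\<in>L2. AE x in lborel.
           feynman_kac M X V t f x = (LINT y|lborel. of_real (u t x y) * f y)))"

section \<open>The two-sided process\<close>

definition paths :: "(real \<Rightarrow> 'a::euclidean_space) set" where
  "paths = {\<omega>. cadlag_on UNIV \<omega>}"

definition path_space :: "(real \<Rightarrow> 'a::euclidean_space) measure" where
  "path_space = sigma paths {{\<omega> \<in> paths. \<omega> t \<in> B} | t B. B \<in> sets borel}"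

definition transition_density ::
    "real \<Rightarrow> ('a \<Rightarrow> real) \<Rightarrow> (real \<Rightarrow> 'a \<Rightarrow> 'a \<Rightarrow> real) \<Rightarrow> real \<Rightarrow> 'a \<Rightarrow> 'a \<Rightarrow> real" where
  "transition_density E \<phi> u t x y = exp (E * t) * u t x y / (\<phi> x * \<phi> y)"

definition transition_prob ::
    "real \<Rightarrow> ('a \<Rightarrow> real) \<Rightarrow> (real \<Rightarrow> 'a \<Rightarrow> 'a \<Rightarrow> real) \<Rightarrow>
     real \<Rightarrow> 'a \<Rightarrow> 'a::euclidean_space measure" where
  "transition_prob E \<phi> u t y =
     density lborel (\<lambda>z. ennreal (transition_density E \<phi> u t y z * (\<phi> z)\<^sup>2))"

text \<open>\<open>p\<close> is the transition function of both one-sided processes, \<open>N x\<close> is the measure usually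
  written \<open>\<mu>\<^sup>x\<close>.\<close>

definition two_sided_markov_laws ::
    "(real \<Rightarrow> 'a \<Rightarrow> 'a::euclidean_space measure) \<Rightarrow> ('a \<Rightarrow> (real \<Rightarrow> 'a) measure) \<Rightarrow> bool" where
  "two_sided_markov_laws p N \<longleftrightarrow>
     (\<forall>x. prob_space (N x) \<and> sets (N x) = sets path_space \<and>
          (AE \<omega> in N x. \<omega> 0 = x) \<and>
          prob_space.indep_set (N x)
            (sets (generated (N x) (\<lambda>t \<omega>. \<omega> t) {0..}))
            (sets (generated (N x) (\<lambda>t \<omega>. \<omega> (- t)) {0..})) \<and>
          markov_process (N x) p (\<lambda>t \<omega>. \<omega> t) \<and>
          markov_process (N x) p (\<lambda>t \<omega>. \<omega> (- t)))"

definition P_phi1_measure ::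
    "('a \<Rightarrow> real) \<Rightarrow> ('a \<Rightarrow> (real \<Rightarrow> 'a) measure) \<Rightarrow>
     (real \<Rightarrow> 'a::euclidean_space) measure \<Rightarrow> bool" where
  "P_phi1_measure \<phi> N \<mu> \<longleftrightarrow>
     sets \<mu> = sets path_space \<and>
     (\<forall>A\<in>sets path_space.
        emeasure \<mu> A = (\<integral>\<^sup>+x. emeasure (N x) A * ennreal ((\<phi> x)\<^sup>2) \<partial>lborel))"

end

theory Submission
  imports Defs
begin

text \<open>
  The reason is that \<open>\<mu>\<close> is stationary: for every \<open>r \<noteq> 0\<close> the position \<open>\<omega> r\<close> has law
  \<open>\<phi>\<^sup>2 dx\<close> under \<open>\<mu>\<close>. Hence the expectation of \<open>1 / \<phi> (\<omega> r)\<close> is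
  \<open>\<integral> \<phi> dx\<close>, which is finite and does not depend on \<open>r\<close>. By Tonelli, the expectation of
  \<open>\<Sum>n. a n / \<phi> (\<omega> (\<plusminus> n))\<close> is \<open>(\<Sum>n. a n) * \<integral> \<phi> dx < \<infinity>\<close>, so that
  both series converge almost surely, and then their terms tend to \<open>0\<close>.

  Stationarity usually comes from the eigenvalue equation \<open>T\<^sub>t \<phi> = e\<^bsup>- E t\<^esup> \<phi>\<close>.
  Here it is read off from the existence of the processes: the kernel
  \<open>transition_density E \<phi> u t x z * (\<phi> z)\<^sup>2\<close> is the law at time \<open>t\<close> of a process
  started at \<open>x\<close> (\<open>markov_process_law\<close>), so its integral over \<open>z\<close> is \<open>1\<close> for
  every \<open>x\<close>. Multiplied by \<open>\<phi> x\<close>, this is the eigenvalue equation at \<open>x\<close>. As the kernel \<open>u t\<close> is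
  symmetric, the same identity says that \<open>(\<phi> x)\<^sup>2 dx\<close> is invariant under the transition
  kernel (\<open>P_phi1_measure_marginal\<close>).
\<close>

text \<open>
  At starting time \<open>0\<close> the conditional probability of \<open>Y t \<in> B\<close> is almost surely the constant
  \<open>measure (p t x) B\<close>, and integrating it gives the probability of \<open>Y t \<in> B\<close>. The definition of
  a Markov process only speaks of the real-valued \<open>measure\<close>, which is \<open>0\<close> on sets of infinite
  mass; the case \<open>B = UNIV\<close> shows that \<open>p t x\<close> has mass \<open>1\<close> and thereby turns this into
  an identity of measures.
\<close>

lemma markov_process_law:
  fixes Y :: "real \<Rightarrow> 'w \<Rightarrow> 'a::euclidean_space"
  assumes P: "prob_space P" and Y: "markov_process P p Y"
    and start: "AE \<omega> in P. Y 0 \<omega> = x"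
    and t: "0 < t" and sets_p: "sets (p t x) = sets borel"
  shows "prob_space (p t x)" and "distr P borel (Y t) = p t x"
proof -
  interpret P: prob_space P by fact
  have Y_meas: "Y r \<in> borel_measurable P" if "0 \<le> r" for r
    using Y that by (auto simp: markov_process_def)
  have [measurable]: "Y t \<in> borel_measurable P" using Y_meas t by simp
  define F where "F = generated P Y {0..0}"
  have "(\<lambda>\<omega>. \<lambda>r\<in>{0..0}. Y r \<omega>) \<in> P \<rightarrow>\<^sub>M (\<Pi>\<^sub>M r\<in>{0..0}. borel)"
    by (rule measurable_restrict) (auto intro: Y_meas)
  then have "subalgebra P F"
    unfolding subalgebra_def F_def generated_def
    by (simp add: measurable_iff_sets)
  then interpret F: finite_measure_subalgebra P F
    by unfold_locales
  have law: "measure P (Y t -` B \<inter> space P) = measure (p t x) B" if B: "B \<in> sets borel" for B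
  proof -
    have [measurable]: "B \<in> sets borel" by (rule B)
    let ?f = "\<lambda>\<omega>. indicator B (Y t \<omega>) :: real"
    have int: "integrable P ?f"
      by (rule P.integrable_const_bound[where B = 1]) (auto simp: indicator_def)
    have "AE \<omega> in P. real_cond_exp P F (\<lambda>\<omega>'. indicator B (Y (0 + t) \<omega>')) \<omega>
                   = measure (p t (Y 0 \<omega>)) B"
      using Y t B unfolding markov_process_def F_def by blast
    with start have ae: "AE \<omega> in P. real_cond_exp P F ?f \<omega> = measure (p t x) B"
      by eventually_elim simp
    have "measure P (Y t -` B \<inter> space P) = (LINT \<omega>|P. ?f \<omega>)"
    proof -
      have "(LINT \<omega>|P. ?f \<omega>) = (LINT \<omega>|P. indicator (Y t -` B \<inter> space P) \<omega>)"
        by (rule Bochner_Integration.integral_cong) (auto simp: indicator_def)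
      then show ?thesis by simp
    qed
    also have "\<dots> = (LINT \<omega>|P. real_cond_exp P F ?f \<omega>)"
      using F.real_cond_exp_int(2)[OF int] by simp
    also have "\<dots> = (LINT \<omega>|P. measure (p t x) B)"
      using ae by (intro integral_cong_AE) auto
    also have "\<dots> = measure (p t x) B"
      by (simp add: P.prob_space)
    finally show ?thesis .
  qed
  have space_p: "space (p t x) = UNIV"
    using sets_eq_imp_space_eq[OF sets_p] by simp
  have mass: "measure (p t x) UNIV = 1"
    using law[of UNIV] P.prob_space by simp
  then have "emeasure (p t x) UNIV \<noteq> top"
    by (auto simp: measure_def)
  then have "emeasure (p t x) (space (p t x)) = 1"
    unfolding space_p using mass by (simp add: emeasure_eq_ennreal_measure)
  then show prob: "prob_space (p t x)"
    by (rule prob_spaceI)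
  then interpret p: prob_space "p t x" .
  show "distr P borel (Y t) = p t x"
  proof (rule measure_eqI)
    fix B assume "B \<in> sets (distr P borel (Y t))"
    then have "B \<in> sets borel" by simp
    then show "emeasure (distr P borel (Y t)) B = emeasure (p t x) B"
      by (simp add: emeasure_distr P.emeasure_eq_measure p.emeasure_eq_measure law)
  qed (simp add: sets_p)
qed

lemma coordinate_measurable:
  fixes L :: "(real \<Rightarrow> 'a::euclidean_space) measure"
  assumes "sets L = sets path_space"
  shows "(\<lambda>\<omega>. \<omega> r) \<in> borel_measurable L"
proof -
  have "(\<lambda>\<omega>. \<omega> r) \<in> borel_measurable (path_space :: (real \<Rightarrow> 'a) measure)"
  proof (rule measurableI)
    fix B :: "'a set" assume "B \<in> sets borel"
    then show "(\<lambda>\<omega>. \<omega> r) -` B \<inter> space path_space \<in> sets path_space"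
      unfolding path_space_def
      by (simp add: space_measure_of_conv, subst sets_measure_of) 
        (auto intro!: sigma_sets.Basic exI[of _ r] exI[of _ B])
  qed auto
  then show ?thesis
    using measurable_cong_sets[OF assms refl] by blast
qed

text \<open>
  Invariance of \<open>\<phi>\<^sup>2 dx\<close>. In the double integral of
  \<open>transition_density E \<phi> u t x z * (\<phi> z)\<^sup>2 * (\<phi> x)\<^sup>2\<close> the roles of \<open>x\<close>
  and \<open>z\<close> may be exchanged because \<open>u t\<close> is symmetric; integrating over \<open>x\<close> first then
  gives \<open>(\<phi> z)\<^sup>2\<close>, since the kernels are probability measures. The time \<open>t\<close> of the kernel
  is kept separate from the time \<open>r\<close> of the path in order to cover both halves of the time axis.
\<close>

lemma P_phi1_measure_marginal:
  fixes \<phi> :: "'a::euclidean_space \<Rightarrow> real"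
  assumes mu: "P_phi1_measure \<phi> N \<mu>"
    and N_sets: "\<And>x. sets (N x) = sets path_space"
    and N_law: "\<And>x. distr (N x) borel (\<lambda>\<omega>. \<omega> r) = transition_prob E \<phi> u t x"
    and prob: "\<And>x. prob_space (transition_prob E \<phi> u t x)"
    and phi_meas [measurable]: "\<phi> \<in> borel_measurable borel"
    and u_meas: "(\<lambda>(x, y). u t x y) \<in> borel_measurable borel"
    and u_sym: "\<And>x y. u t x y = u t y x"
  shows "distr \<mu> borel (\<lambda>\<omega>. \<omega> r) = density lborel (\<lambda>z. ennreal ((\<phi> z)\<^sup>2))"
proof (rule measure_eqI)
  have mu_sets: "sets \<mu> = sets path_space"
    using mu by (simp add: P_phi1_measure_def)
  have [measurable]: "(\<lambda>\<omega>. \<omega> r) \<in> borel_measurable \<mu>"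
    by (rule coordinate_measurable[OF mu_sets])
  have [measurable]: "(\<lambda>(x, y). u t x y) \<in> borel_measurable (borel \<Otimes>\<^sub>M borel)"
    using u_meas by (simp add: borel_prod)
  let ?k = "\<lambda>x z. ennreal (transition_density E \<phi> u t x z * (\<phi> z)\<^sup>2)"
  have [measurable]: "(\<lambda>(x, z). ?k x z) \<in> borel_measurable (borel \<Otimes>\<^sub>M borel)"
    unfolding transition_density_def by measurable
  have k_sym: "?k x z * ennreal ((\<phi> x)\<^sup>2) = ?k z x * ennreal ((\<phi> z)\<^sup>2)" for x z
  proof -
    have "transition_density E \<phi> u t x z * (\<phi> z)\<^sup>2 * (\<phi> x)\<^sup>2
        = transition_density E \<phi> u t z x * (\<phi> x)\<^sup>2 * (\<phi> z)\<^sup>2"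
      by (simp add: transition_density_def u_sym[of x z] mult_ac)
    then show ?thesis
      by (metis ennreal_mult'' zero_le_power2)
  qed
  have k_mass: "(\<integral>\<^sup>+x. ?k z x \<partial>lborel) = 1" for z
    using prob_space.emeasure_space_1[OF prob[of z]]
    by (simp add: transition_prob_def emeasure_density)
  fix B assume "B \<in> sets (distr \<mu> borel (\<lambda>\<omega>. \<omega> r))"
  then have B [measurable]: "B \<in> sets borel" by simp
  let ?A = "(\<lambda>\<omega>. \<omega> r) -` B \<inter> space \<mu>"
  have A: "?A \<in> sets path_space"
    unfolding mu_sets[symmetric] by measurable
  have space_N: "space (N x) = space \<mu>" for x
    using sets_eq_imp_space_eq[OF N_sets[of x]] sets_eq_imp_space_eq[OF mu_sets] by simp
  have N_A: "emeasure (N x) ?A = (\<integral>\<^sup>+z. ?k x z * indicator B z \<partial>lborel)" for x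
  proof -
    have "emeasure (N x) ?A = emeasure (distr (N x) borel (\<lambda>\<omega>. \<omega> r)) B"
      using coordinate_measurable[OF N_sets[of x]] by (simp add: emeasure_distr space_N)
    also have "\<dots> = (\<integral>\<^sup>+z. ?k x z * indicator B z \<partial>lborel)"
      unfolding N_law transition_prob_def by (rule emeasure_density) auto
    finally show ?thesis .
  qed
  have "emeasure (distr \<mu> borel (\<lambda>\<omega>. \<omega> r)) B = emeasure \<mu> ?A"
    by (simp add: emeasure_distr)
  also have "\<dots> = (\<integral>\<^sup>+x. emeasure (N x) ?A * ennreal ((\<phi> x)\<^sup>2) \<partial>lborel)"
    using mu A unfolding P_phi1_measure_def by blast
  also have "\<dots> = (\<integral>\<^sup>+x. (\<integral>\<^sup>+z. ?k x z * indicator B z * ennreal ((\<phi> x)\<^sup>2) \<partial>lborel) \<partial>lborel)"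
    by (simp add: N_A nn_integral_multc)
  also have "\<dots> = (\<integral>\<^sup>+x. (\<integral>\<^sup>+z. ?k z x * (ennreal ((\<phi> z)\<^sup>2) * indicator B z) \<partial>lborel) \<partial>lborel)"
    using k_sym by (simp add: mult_ac)
  also have "\<dots> = (\<integral>\<^sup>+z. (\<integral>\<^sup>+x. ?k z x * (ennreal ((\<phi> z)\<^sup>2) * indicator B z) \<partial>lborel) \<partial>lborel)"
    by (rule lborel_pair.Fubini') measurable
  also have "\<dots> = (\<integral>\<^sup>+z. ennreal ((\<phi> z)\<^sup>2) * indicator B z \<partial>lborel)"
    by (simp add: nn_integral_multc k_mass)
  also have "\<dots> = emeasure (density lborel (\<lambda>z. ennreal ((\<phi> z)\<^sup>2))) B"
    by (simp add: emeasure_density)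
  finally show "emeasure (distr \<mu> borel (\<lambda>\<omega>. \<omega> r)) B
      = emeasure (density lborel (\<lambda>z. ennreal ((\<phi> z)\<^sup>2))) B" .
qed simp

text \<open>
  The terms tend to \<open>0\<close> because the series \<open>\<Sum>n. c n / \<phi> (Z n)\<close> converges almost surely: the
  density \<open>\<phi>\<^sup>2\<close> cancels the denominator, so each \<open>1 / \<phi> (Z n)\<close> has expectation
  \<open>\<integral> \<phi>\<close> and the expectation of the series is finite.
\<close>

lemma AE_quotient_tendsto_0:
  fixes \<phi> :: "'a::euclidean_space \<Rightarrow> real"
  assumes Z [measurable]: "\<And>n. Z n \<in> borel_measurable \<mu>"
    and law: "\<And>n. distr \<mu> borel (Z n) = density lborel (\<lambda>z. ennreal ((\<phi> z)\<^sup>2))"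
    and phi_pos: "\<And>x. 0 < \<phi> x" and phi_L1: "integrable lborel \<phi>"
    and c_nonneg: "\<And>n. 0 \<le> c n" and c: "summable c"
  shows "AE \<omega> in \<mu>. (\<lambda>n. c n / \<phi> (Z n \<omega>)) \<longlonglongrightarrow> 0"
proof -
  have [measurable]: "\<phi> \<in> borel_measurable borel"
    using borel_measurable_integrable[OF phi_L1] by simp
  define I where "I = (LINT x|lborel. \<phi> x)"
  have I: "(\<integral>\<^sup>+x. ennreal (\<phi> x) \<partial>lborel) = ennreal I"
    unfolding I_def using phi_L1 phi_pos by (intro nn_integral_eq_integral) (auto intro: less_imp_le)
  have I_nonneg: "0 \<le> I"
    unfolding I_def by (intro Bochner_Integration.integral_nonneg) (simp add: phi_pos less_imp_le)
  have expectation: "(\<integral>\<^sup>+\<omega>. ennreal (c n / \<phi> (Z n \<omega>)) \<partial>\<mu>) = ennreal (c n * I)" for n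
  proof -
    have "(\<integral>\<^sup>+\<omega>. ennreal (c n / \<phi> (Z n \<omega>)) \<partial>\<mu>)
        = (\<integral>\<^sup>+z. ennreal (c n / \<phi> z) \<partial>distr \<mu> borel (Z n))"
      by (simp add: nn_integral_distr)
    also have "\<dots> = (\<integral>\<^sup>+z. ennreal ((\<phi> z)\<^sup>2) * ennreal (c n / \<phi> z) \<partial>lborel)"
      unfolding law by (rule nn_integral_density) auto
    also have "\<dots> = (\<integral>\<^sup>+z. ennreal (c n) * ennreal (\<phi> z) \<partial>lborel)"
    proof (rule nn_integral_cong)
      fix z
      have "(\<phi> z)\<^sup>2 * (c n / \<phi> z) = c n * \<phi> z"
        using phi_pos[of z] by (simp add: power2_eq_square)
      then show "ennreal ((\<phi> z)\<^sup>2) * ennreal (c n / \<phi> z) = ennreal (c n) * ennreal (\<phi> z)"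
        using c_nonneg[of n] by (metis ennreal_mult' zero_le_power2)
    qed
    also have "\<dots> = ennreal (c n * I)"
      using c_nonneg[of n] by (simp add: nn_integral_cmult I ennreal_mult')
    finally show ?thesis .
  qed
  have "(\<integral>\<^sup>+\<omega>. (\<Sum>n. ennreal (c n / \<phi> (Z n \<omega>))) \<partial>\<mu>) = (\<Sum>n. ennreal (c n * I))"
    by (subst nn_integral_suminf) (simp_all add: expectation)
  also have "\<dots> \<noteq> \<infinity>"
    using summable_mult2[OF c, of I] c_nonneg I_nonneg
    by (simp add: suminf_ennreal2)
  finally have "AE \<omega> in \<mu>. (\<Sum>n. ennreal (c n / \<phi> (Z n \<omega>))) \<noteq> \<infinity>"
    by (intro nn_integral_noteq_infinite) auto
  then show ?thesis
  proof eventually_elim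
    case (elim \<omega>)
    then have "summable (\<lambda>n. c n / \<phi> (Z n \<omega>))"
      using c_nonneg phi_pos
      by (intro summable_suminf_not_top) (auto intro!: divide_nonneg_pos)
    then show ?case
      by (rule summable_LIMSEQ_zero)
  qed
qed

lemma tendsto_filtercomap_abs_int:
  fixes f :: "int \<Rightarrow> 'b::topological_space"
  assumes pos: "(\<lambda>n. f (int (Suc n))) \<longlonglongrightarrow> l" and neg: "(\<lambda>n. f (- int (Suc n))) \<longlonglongrightarrow> l"
  shows "(f \<longlongrightarrow> l) (filtercomap (\<lambda>N::int. \<bar>N\<bar>) at_top)"
proof (rule topological_tendstoI)
  fix S assume "open S" "l \<in> S"
  then have "\<forall>\<^sub>F n in sequentially. f (int (Suc n)) \<in> S \<and> f (- int (Suc n)) \<in> S"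
    using pos neg by (auto intro: eventually_conj topological_tendstoD)
  then obtain n0 where n0: "\<And>n. n \<ge> n0 \<Longrightarrow> f (int (Suc n)) \<in> S \<and> f (- int (Suc n)) \<in> S"
    by (auto simp: eventually_sequentially)
  have "f N \<in> S" if "int (Suc n0) \<le> \<bar>N\<bar>" for N
  proof -
    define n where "n = nat \<bar>N\<bar> - 1"
    have n: "n \<ge> n0" and "N = int (Suc n) \<or> N = - int (Suc n)"
      using that by (auto simp: n_def)
    then show ?thesis using n0[OF n] by metis
  qed
  then show "\<forall>\<^sub>F N in filtercomap (\<lambda>N::int. \<bar>N\<bar>) at_top. f N \<in> S"
    unfolding eventually_filtercomap_at_top_linorder by blast
qed

theorem theorem5p3:
  fixes \<alpha> :: real
    and M :: "'w measure"
    and X :: "real \<Rightarrow> 'w \<Rightarrow> 'a::euclidean_space"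
    and V :: "'a \<Rightarrow> real"
    and H :: "'a l2_operator"
    and \<phi> :: "'a \<Rightarrow> real"
    and u :: "real \<Rightarrow> 'a \<Rightarrow> 'a \<Rightarrow> real"
    and \<mu>x :: "'a \<Rightarrow> (real \<Rightarrow> 'a) measure"
    and \<mu> :: "(real \<Rightarrow> 'a) measure"
    and a :: "nat \<Rightarrow> real"
  assumes alpha: "0 < \<alpha>" "\<alpha> < 2"
    and X: "stable_process \<alpha> M X"
    and V: "kato_decomposable M X V"
    and H: "schroedinger_operator M X V H"
    and isolated_eigenvalue: "of_real (inf_spectrum H) isolated_in spectrum_of H"
      "eigenvalue_of H (of_real (inf_spectrum H))"
    and phi: "ground_state H \<phi>"
    and phi_L1: "integrable lborel \<phi>"
    and u: "feynman_kac_kernel M X V u"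
    and mux: "two_sided_markov_laws (transition_prob (inf_spectrum H) \<phi> u) \<mu>x"
    and mu: "P_phi1_measure \<phi> \<mu>x \<mu>"
    and a_pos: "\<And>n. n \<ge> 1 \<Longrightarrow> a n > 0"
    and a_summable: "summable (\<lambda>n. a (Suc n))"
  shows "AE \<omega> in \<mu>. ((\<lambda>N::int. a (nat \<bar>N\<bar>) / \<phi> (\<omega> (of_int N))) \<longlongrightarrow> 0)
                       (filtercomap (\<lambda>N::int. \<bar>N\<bar>) at_top)"
proof -
  define E where "E = inf_spectrum H"
  have phi_pos: "\<And>x. 0 < \<phi> x" and phi_cont: "continuous_on UNIV \<phi>"
    using phi by (auto simp: ground_state_def)
  have phi_meas: "\<phi> \<in> borel_measurable borel"
    by (rule borel_measurable_continuous_onI[OF phi_cont])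
  have laws: "prob_space (\<mu>x x)" "sets (\<mu>x x) = sets path_space" "AE \<omega> in \<mu>x x. \<omega> 0 = x"
    "markov_process (\<mu>x x) (transition_prob E \<phi> u) (\<lambda>t \<omega>. \<omega> t)"
    "markov_process (\<mu>x x) (transition_prob E \<phi> u) (\<lambda>t \<omega>. \<omega> (- t))" for x
    using mux unfolding two_sided_markov_laws_def E_def by blast+
  have mu_sets: "sets \<mu> = sets path_space"
    using mu by (simp add: P_phi1_measure_def)
  have stationary: "distr \<mu> borel (\<lambda>\<omega>. \<omega> r) = density lborel (\<lambda>z. ennreal ((\<phi> z)\<^sup>2))"
    if r: "r \<noteq> 0" for r
  proof (rule P_phi1_measure_marginal[OF mu laws(2) _ _ phi_meas])
    have t: "0 < \<bar>r\<bar>" using r by simp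
    have sets_p: "sets (transition_prob E \<phi> u \<bar>r\<bar> x) = sets borel" for x
      by (simp add: transition_prob_def)
    have start: "AE \<omega> in \<mu>x x. \<omega> (- 0) = x" for x
      using laws(3)[of x] by simp
    note forward = markov_process_law[OF laws(1) laws(4) laws(3) t sets_p]
      and backward = markov_process_law[OF laws(1) laws(5) start t sets_p]
    show "prob_space (transition_prob E \<phi> u \<bar>r\<bar> x)" for x
      by (rule forward)
    show "distr (\<mu>x x) borel (\<lambda>\<omega>. \<omega> r) = transition_prob E \<phi> u \<bar>r\<bar> x" for x
      using forward(2)[of x] backward(2)[of x] by (cases "r \<ge> 0") auto
    show "(\<lambda>(x, y). u \<bar>r\<bar> x y) \<in> borel_measurable borel"
      using u t by (intro borel_measurable_continuous_onI) (auto simp: feynman_kac_kernel_def)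
    show "u \<bar>r\<bar> x y = u \<bar>r\<bar> y x" for x y
      using u t unfolding feynman_kac_kernel_def by blast
  qed
  have a_nonneg: "0 \<le> a (Suc n)" for n
    using a_pos[of "Suc n"] by simp
  have quotient: "AE \<omega> in \<mu>. (\<lambda>n. a (Suc n) / \<phi> (\<omega> (\<sigma> * real (Suc n)))) \<longlonglongrightarrow> 0"
    if "\<sigma> \<noteq> 0" for \<sigma>
    using that
    by (intro AE_quotient_tendsto_0[where c = "\<lambda>n. a (Suc n)"] coordinate_measurable[OF mu_sets]
        stationary phi_pos phi_L1 a_nonneg a_summable) simp_all
  have "AE \<omega> in \<mu>. (\<lambda>n. a (Suc n) / \<phi> (\<omega> (1 * real (Suc n)))) \<longlonglongrightarrow> 0"
    "AE \<omega> in \<mu>. (\<lambda>n. a (Suc n) / \<phi> (\<omega> (- 1 * real (Suc n)))) \<longlonglongrightarrow> 0"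
    by (rule quotient; simp)+
  then show ?thesis
  proof eventually_elim
    case (elim \<omega>)
    show ?case
    proof (rule tendsto_filtercomap_abs_int)
      have "nat \<bar>int (Suc n)\<bar> = Suc n" "nat \<bar>- int (Suc n)\<bar> = Suc n"
        "of_int (int (Suc n)) = 1 * real (Suc n)" "of_int (- int (Suc n)) = - 1 * real (Suc n)" for n
        by simp_all
      note eqs = this
      show "(\<lambda>n. a (nat \<bar>int (Suc n)\<bar>) / \<phi> (\<omega> (of_int (int (Suc n))))) \<longlonglongrightarrow> 0"
        using elim(1) unfolding eqs .
      show "(\<lambda>n. a (nat \<bar>- int (Suc n)\<bar>) / \<phi> (\<omega> (of_int (- int (Suc n))))) \<longlonglongrightarrow> 0"
        using elim(2) unfolding eqs .
    qed
  qed
qed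

end
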